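(* Let $\mathcal H$ be the Hecke algebra of $G_4$. The following twelve elements together form an $R$-basis of the centralizer $Z_{\mathcal H}(\tilde T_t)$ of $\tilde T_t$ in $\mathcal H$: (1) $\tilde T_1$; (2) $\tilde T_t$; (3) $\tilde T_{t^2}$; (4) $\tilde T_{st^2s}$; (5) $\tilde T_{s^2ts^2}$; (6) $\tilde T_{ststst}$; (7) $\tilde T_s+\tilde T_{t^2st}+\tilde T_{tst^2}-\xi_2\tilde T_{tst}$; (8) $\tilde T_{s^2}+\tilde T_{t^2s^2t}+\tilde T_{ts^2t^2}-\xi_2\tilde T_{ts^2t}$; (9) $\tilde T_{ts}+\tilde T_{st}+\tilde T_{t^2st^2}+\xi_1\tilde T_{tst}$; (10) $\tilde T_{ts^2}+\tilde T_{s^2t}+\tilde T_{t^2s^2t^2}+\xi_1\tilde T_{ts^2t}$; (11) $\tilde T_{t^2s}+\tilde T_{st^2}+\tilde T_{tst}+\xi_1\tilde T_{t^2st}+\xi_1\tilde T_{tst^2}+\xi_2\tilde T_{t^2st^2}$; (12) $\tilde T_{t^2s^2}+\tilde T_{s^2t^2}+\tilde T_{ts^2t}+\xi_1\tilde T_{t^2s^2t}+\xi_1\tilde T_{ts^2t^2}+\xi_2\tilde T_{t^2s^2t^2}$.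
   Context: $G_4=\langle s,t\mid s^3=t^3=1,\ sts=tst\rangle$ (a group of order 24). Let $\xi_1,\xi_2$ be indeterminates and $R=\mathbb Z[\xi_1,\xi_2]$. The Hecke algebra $\mathcal H$ of $G_4$ is the $R$-algebra generated by $\tilde T_s,\tilde T_t$ subject to $\tilde T_s\tilde T_t\tilde T_s=\tilde T_t\tilde T_s\tilde T_t$ and $\tilde T_x^3=1+\xi_1\tilde T_x+\xi_2\tilde T_x^2$ for $x\in\{s,t\}$. For a word $x_1\cdots x_k$ in $s,t$ put $\tilde T_{x_1\cdots x_k}=\tilde T_{x_1}\cdots\tilde T_{x_k}$, $\tilde T_1=1$. $\mathcal H$ is a free $R$-module of rank 24, with $R$-basis $B_{tst}$ consisting of the elements $\tilde T_w$ for the words $w\in\{1,s,t,s^2,t^2,st,ts,st^2,t^2s,s^2t,ts^2,s^2t^2,t^2s^2,st^2s,ts^2t,s^2ts^2,t^2st^2,ststst,tst,t^2st,tst^2,ts^2t^2,t^2s^2t,t^2s^2t^2\}$. *)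

theory Defs
  imports
    "HOL-Library.Poly_Mapping"
    "HOL-Computational_Algebra.Polynomial"
begin

text \<open>
  The coefficient ring $R = Z[\xi_1, \xi_2]$ is represented as $Z[\xi_1][\xi_2]$.
\<close>

type_synonym coeff_ring = "int poly poly"

definition \<xi>\<^sub>1 :: coeff_ring where
  "\<xi>\<^sub>1 = [:[:0, 1:]:]"

definition \<xi>\<^sub>2 :: coeff_ring where
  "\<xi>\<^sub>2 = [:0, 1:]"


text \<open>
  The free associative $R$-algebra on a set of generators is the monoid algebra of the
  free monoid. Multiplication on \<^typ>\<open>'a \<Rightarrow>\<^sub>0 'b\<close> is convolution along the
  addition of \<^typ>\<open>'a\<close>, so words carry concatenation as their (non-commutative)
  addition.
\<close>

datatype 'a word = Word (letters: "'a list")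

instantiation word :: (type) monoid_add
begin

definition zero_word :: "'a word" where
  "0 = Word []"

definition plus_word :: "'a word \<Rightarrow> 'a word \<Rightarrow> 'a word" where
  "u + v = Word (letters u @ letters v)"

instance
  by standard (simp_all add: zero_word_def plus_word_def)

end

type_synonym ('g, 'r) free_algebra = "'g word \<Rightarrow>\<^sub>0 'r"

definition free_const :: "'r \<Rightarrow> ('g, 'r::comm_ring_1) free_algebra" where
  "free_const r = Poly_Mapping.single 0 r"

definition free_gen :: "'g \<Rightarrow> ('g, 'r::comm_ring_1) free_algebra" where
  "free_gen x = Poly_Mapping.single (Word [x]) 1"

lemma free_const_0: "free_const 0 = 0"
  and free_const_1: "free_const 1 = 1"
  and free_const_add: "free_const (a + b) = free_const a + free_const b"
  and free_const_mult: "free_const (a * b) = free_const a * free_const b"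
  by (simp_all add: free_const_def single_add mult_single)


inductive_set two_sided_ideal :: "'a::ring_1 set \<Rightarrow> 'a set" for X where
  zero: "0 \<in> two_sided_ideal X"
| gen: "x \<in> X \<Longrightarrow> a * x * b \<in> two_sided_ideal X"
| add: "x \<in> two_sided_ideal X \<Longrightarrow> y \<in> two_sided_ideal X \<Longrightarrow> x + y \<in> two_sided_ideal X"

lemma two_sided_ideal_lmult: "x \<in> two_sided_ideal X \<Longrightarrow> c * x \<in> two_sided_ideal X"
proof (induction rule: two_sided_ideal.induct)
  case (gen x a b)
  then show ?case
    using two_sided_ideal.gen[of x X "c * a" b] by (simp add: mult.assoc)
qed (auto simp: distrib_left intro: two_sided_ideal.intros)

lemma two_sided_ideal_rmult: "x \<in> two_sided_ideal X \<Longrightarrow> x * c \<in> two_sided_ideal X"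
proof (induction rule: two_sided_ideal.induct)
  case (gen x a b)
  then show ?case
    using two_sided_ideal.gen[of x X a "b * c"] by (simp add: mult.assoc)
qed (auto simp: distrib_right intro: two_sided_ideal.intros)

lemma two_sided_ideal_uminus: "x \<in> two_sided_ideal X \<Longrightarrow> - x \<in> two_sided_ideal X"
  using two_sided_ideal_lmult[of x X "- 1"] by simp


text \<open>
  The Hecke algebra of $G_4 = \langle s, t \mid s^3 = t^3 = 1, sts = tst \rangle$ is given by
  its presentation; freeness of rank 24 over $R$ is a theorem about it and not built in.
  The generators are called \<open>gs\<close> and \<open>gt\<close> to keep \<open>s\<close> and \<open>t\<close> available as variables.
\<close>

datatype generator = gs | gt

definition hecke_relators :: "(generator, coeff_ring) free_algebra set" where
  "hecke_relators =
     insert (free_gen gs * free_gen gt * free_gen gs - free_gen gt * free_gen gs * free_gen gt)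
       (range (\<lambda>x. free_gen x ^ 3
          - (1 + free_const \<xi>\<^sub>1 * free_gen x + free_const \<xi>\<^sub>2 * free_gen x ^ 2)))"

definition hecke_eq ::
  "(generator, coeff_ring) free_algebra \<Rightarrow> (generator, coeff_ring) free_algebra \<Rightarrow> bool" where
  "hecke_eq p q \<longleftrightarrow> p - q \<in> two_sided_ideal hecke_relators"

lemma equivp_hecke_eq: "equivp hecke_eq"
proof (rule equivpI)
  show "reflp hecke_eq"
    by (simp add: reflp_def hecke_eq_def two_sided_ideal.zero)
  show "symp hecke_eq"
    unfolding symp_def hecke_eq_def
    using two_sided_ideal_uminus by fastforce
  show "transp hecke_eq"
    unfolding transp_def hecke_eq_def
    using two_sided_ideal.add by fastforce
qed

quotient_type hecke = "(generator, coeff_ring) free_algebra" / hecke_eq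
  by (rule equivp_hecke_eq)

instantiation hecke :: ring
begin

lift_definition zero_hecke :: hecke is 0 .

lift_definition plus_hecke :: "hecke \<Rightarrow> hecke \<Rightarrow> hecke" is "(+)"
  unfolding hecke_eq_def by (metis add_diff_add two_sided_ideal.add)

lift_definition uminus_hecke :: "hecke \<Rightarrow> hecke" is uminus
  unfolding hecke_eq_def by (metis minus_diff_minus two_sided_ideal_uminus)

lift_definition minus_hecke :: "hecke \<Rightarrow> hecke \<Rightarrow> hecke" is "(-)"
proof -
  fix a b c d
  assume "hecke_eq a b" "hecke_eq c d"
  then have "(a - b) + - (c - d) \<in> two_sided_ideal hecke_relators"
    unfolding hecke_eq_def by (intro two_sided_ideal.add two_sided_ideal_uminus)
  then show "hecke_eq (a - c) (b - d)"
    by (simp add: hecke_eq_def algebra_simps)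
qed

lift_definition times_hecke :: "hecke \<Rightarrow> hecke \<Rightarrow> hecke" is "(*)"
proof -
  fix a b c d
  assume "hecke_eq a b" "hecke_eq c d"
  then have "(a - b) * c + b * (c - d) \<in> two_sided_ideal hecke_relators"
    unfolding hecke_eq_def
    by (intro two_sided_ideal.add two_sided_ideal_lmult two_sided_ideal_rmult)
  then show "hecke_eq (a * c) (b * d)"
    by (simp add: hecke_eq_def algebra_simps)
qed

instance
  by (standard; transfer; simp add: algebra_simps hecke_eq_def two_sided_ideal.zero)

end

instantiation hecke :: monoid_mult
begin

lift_definition one_hecke :: hecke is 1 .

instance
  by (standard; transfer; simp add: hecke_eq_def two_sided_ideal.zero)

end

definition hecke_const :: "coeff_ring \<Rightarrow> hecke" where
  "hecke_const r = abs_hecke (free_const r)"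

definition hecke_scale :: "coeff_ring \<Rightarrow> hecke \<Rightarrow> hecke" (infixr "*\<^sub>H" 75) where
  "r *\<^sub>H x = hecke_const r * x"

lemma hecke_const_1: "hecke_const 1 = 1"
  and hecke_const_add: "hecke_const (a + b) = hecke_const a + hecke_const b"
  and hecke_const_mult: "hecke_const (a * b) = hecke_const a * hecke_const b"
  by (simp_all add: hecke_const_def free_const_1 free_const_add free_const_mult
      one_hecke_def plus_hecke.abs_eq times_hecke.abs_eq)

global_interpretation hecke: module hecke_scale
  by standard
    (simp_all add: hecke_scale_def hecke_const_1 hecke_const_add hecke_const_mult
      algebra_simps)

lift_definition hecke_gen :: "generator \<Rightarrow> hecke" is free_gen .

definition T :: "generator list \<Rightarrow> hecke" where
  "T w = prod_list (map hecke_gen w)"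

definition centralizer :: "'a::ring \<Rightarrow> 'a set" where
  "centralizer a = {x. x * a = a * x}"

end

theory Submission
  imports Defs "HOL-Library.Product_Plus"
begin

text \<open>
  Write \<open>s\<close>, \<open>t\<close> for the generators of the Hecke algebra and \<open>A = R[t]\<close>, a free \<open>R\<close>-module with
  basis \<open>1, t, t\<^sup>2\<close>. In the braid group \<open>u = s t\<^sup>2 s\<close> commutes with \<open>t\<close>, and
  \<open>s\<^sup>2 t s\<^sup>2 = u t\<close>, \<open>(s t)\<^sup>3 = u t\<^sup>2\<close>. So the basis \<open>B\<^sub>t\<^sub>s\<^sub>t\<close> says that the algebra is the direct sum
  \<open>A \<oplus> A s A \<oplus> A s\<^sup>2 A \<oplus> u A\<close> of \<open>A\<close>-bimodules, where the middle summands are copies of \<open>A \<otimes> A\<close>.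
  The decomposition is established by writing down the action of \<open>s\<close> and \<open>t\<close> on the free right
  \<open>A\<close>-module \<open>A\<^sup>8\<close> and checking the defining relations there.
  The centralizer of \<open>t\<close> then splits accordingly: \<open>A\<close> and \<open>u A\<close> lie in it, and in \<open>A \<otimes> A\<close> the elements
  \<open>m\<close> with \<open>t m = m t\<close> form the free rank one \<open>A\<close>-module generated by the Casimir element.
\<close>

section \<open>Spans and independence of lists; induction on finitely supported functions\<close>

lemma (in module) span_set_list:
  assumes "distinct xs"
  shows "span (set xs) = range (\<lambda>c. \<Sum>i<length xs. c i *s xs ! i)"
proof
  show "span (set xs) \<subseteq> range (\<lambda>c. \<Sum>i<length xs. c i *s xs ! i)"
  proof (clarsimp simp: span_finite)
    fix u
    have "(\<Sum>v\<in>set xs. u v *s v) = (\<Sum>i<length xs. u (xs ! i) *s xs ! i)"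
      using sum.reindex_bij_betw[OF bij_betw_nth[OF assms refl refl], of "\<lambda>v. u v *s v"] by simp
    then show "(\<Sum>v\<in>set xs. u v *s v) \<in> range (\<lambda>c. \<Sum>i<length xs. c i *s xs ! i)"
      by (intro image_eqI[of _ _ "\<lambda>i. u (xs ! i)"]) auto
  qed
qed (auto intro!: span_sum span_scale[OF span_base])

lemma (in module) distinct_independent_listI:
  assumes zero: "\<And>c i. (\<Sum>i<length xs. c i *s xs ! i) = 0 \<Longrightarrow> i < length xs \<Longrightarrow> c i = 0"
    and "(1 :: 'a) \<noteq> 0"
  shows "distinct xs \<and> independent (set xs)"
proof
  show distinct: "distinct xs"
    unfolding distinct_conv_nth
  proof (intro allI impI notI)
    fix i j assume ij: "i < length xs" "j < length xs" "i \<noteq> j" "xs ! i = xs ! j"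
    \<comment> \<open>Equal entries at \<open>i\<close> and \<open>j\<close> give the relation with
      coefficients \<open>1\<close> and \<open>-1\<close> there, which \<open>zero\<close>
      forbids.\<close>
    define c :: "nat \<Rightarrow> 'a" where "c k = (if k = i then 1 else 0) - (if k = j then 1 else 0)" for k
    have "(\<Sum>k<length xs. c k *s xs ! k)
        = (\<Sum>k<length xs. if k = i then xs ! k else 0) - (\<Sum>k<length xs. if k = j then xs ! k else 0)"
      unfolding sum_subtractf[symmetric]
      by (rule sum.cong) (auto simp: c_def scale_left_diff_distrib)
    also have "\<dots> = 0"
      using ij by simp
    finally have "c i = 0"
      using zero ij by blast
    with ij assms(2) show False
      by (simp add: c_def)
  qed
  show "independent (set xs)"
  proof
    assume "dependent (set xs)"
    then obtain u v where u: "v \<in> set xs" "u v \<noteq> 0" "(\<Sum>v\<in>set xs. u v *s v) = 0"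
      by (auto simp: dependent_finite)
    have "(\<Sum>i<length xs. u (xs ! i) *s xs ! i) = (\<Sum>v\<in>set xs. u v *s v)"
      using sum.reindex_bij_betw[OF bij_betw_nth[OF distinct refl refl], of "\<lambda>v. u v *s v"] by simp
    moreover obtain i where "i < length xs" "v = xs ! i"
      using u(1) by (metis in_set_conv_nth)
    ultimately show False
      using u(2,3) zero[of "\<lambda>i. u (xs ! i)" i] by simp
  qed
qed

lemma poly_mapping_single_induct [case_names single add]:
  assumes "\<And>w r. P (Poly_Mapping.single w r)"
    and "\<And>p q. P p \<Longrightarrow> P q \<Longrightarrow> P (p + q)"
  shows "P (p :: 'a \<Rightarrow>\<^sub>0 'b::comm_monoid_add)"
proof -
  have "P (\<Sum>w\<in>A. Poly_Mapping.single w (Poly_Mapping.lookup p w))" if "finite A" for A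
    using that
  proof induction
    case empty
    \<comment> \<open>\<open>0\<close> is itself a \<open>single\<close>, with coefficient
      \<open>0\<close>, hence no separate base case.\<close>
    show ?case using assms(1)[of undefined 0] by simp
  qed (simp add: assms)
  moreover have "p = (\<Sum>w\<in>Poly_Mapping.keys p. Poly_Mapping.single w (Poly_Mapping.lookup p w))"
    by (rule poly_mapping_eqI) (simp add: lookup_sum lookup_single when_def in_keys_iff)
  ultimately show ?thesis
    by (metis finite_keys)
qed

section \<open>The representation on the free module of rank 8\<close>

text \<open>The extension \<open>R[\<tau>] / (\<tau>\<^sup>3 - 1 - \<xi>\<^sub>1 \<tau> - \<xi>\<^sub>2 \<tau>\<^sup>2)\<close>, with coefficients listed in ascending order.\<close>

datatype cubic = Cubic (cubic0: coeff_ring) (cubic1: coeff_ring) (cubic2: coeff_ring)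

instantiation cubic :: comm_ring_1
begin

definition zero_cubic :: cubic where
  "0 = Cubic 0 0 0"

definition one_cubic :: cubic where
  "1 = Cubic 1 0 0"

definition plus_cubic :: "cubic \<Rightarrow> cubic \<Rightarrow> cubic" where
  "x + y = Cubic (cubic0 x + cubic0 y) (cubic1 x + cubic1 y) (cubic2 x + cubic2 y)"

definition uminus_cubic :: "cubic \<Rightarrow> cubic" where
  "- x = Cubic (- cubic0 x) (- cubic1 x) (- cubic2 x)"

definition minus_cubic :: "cubic \<Rightarrow> cubic \<Rightarrow> cubic" where
  "x - y = Cubic (cubic0 x - cubic0 y) (cubic1 x - cubic1 y) (cubic2 x - cubic2 y)"

text \<open>\<open>p3\<close> and \<open>p4\<close> are the product's coefficients in degrees 3 and
  4; the latter is reduced by applying the cubic relation twice.\<close>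

definition times_cubic :: "cubic \<Rightarrow> cubic \<Rightarrow> cubic" where
  "x * y =
    (let p3 = cubic1 x * cubic2 y + cubic2 x * cubic1 y; p4 = cubic2 x * cubic2 y
     in Cubic
          (cubic0 x * cubic0 y + p3 + \<xi>\<^sub>2 * p4)
          (cubic0 x * cubic1 y + cubic1 x * cubic0 y + \<xi>\<^sub>1 * p3 + (1 + \<xi>\<^sub>1 * \<xi>\<^sub>2) * p4)
          (cubic0 x * cubic2 y + cubic1 x * cubic1 y + cubic2 x * cubic0 y
            + \<xi>\<^sub>2 * p3 + (\<xi>\<^sub>1 + \<xi>\<^sub>2 * \<xi>\<^sub>2) * p4))"

instance
  by standard
    (simp_all add: zero_cubic_def one_cubic_def plus_cubic_def uminus_cubic_def
      minus_cubic_def times_cubic_def cubic.expand Let_def algebra_simps)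

end

lemmas cubic_arith =
  zero_cubic_def one_cubic_def plus_cubic_def uminus_cubic_def minus_cubic_def times_cubic_def

definition cubic_of :: "coeff_ring \<Rightarrow> cubic" where
  "cubic_of r = Cubic r 0 0"

definition \<tau> :: cubic where
  "\<tau> = Cubic 0 1 0"

abbreviation X1 :: cubic where "X1 \<equiv> cubic_of \<xi>\<^sub>1"
abbreviation X2 :: cubic where "X2 \<equiv> cubic_of \<xi>\<^sub>2"

lemma cubic_of_0 [simp]: "cubic_of 0 = 0"
  and cubic_of_1 [simp]: "cubic_of 1 = 1"
  and cubic_of_add: "cubic_of (a + b) = cubic_of a + cubic_of b"
  and cubic_of_mult: "cubic_of (a * b) = cubic_of a * cubic_of b"
  by (simp_all add: cubic_of_def cubic_arith)

lemma tau_cubed: "\<tau> * (\<tau> * \<tau>) = 1 + X1 * \<tau> + X2 * (\<tau> * \<tau>)"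
  by (simp add: \<tau>_def cubic_of_def cubic_arith)

lemma tau_cubed': "\<tau> * (\<tau> * (\<tau> * y)) = y + X1 * (\<tau> * y) + X2 * (\<tau> * (\<tau> * y))"
  using arg_cong[OF tau_cubed, of "\<lambda>z. z * y"] by (simp add: algebra_simps)

lemma cubic_expand: "x = cubic_of (cubic0 x) + cubic_of (cubic1 x) * \<tau> + cubic_of (cubic2 x) * (\<tau> * \<tau>)"
  by (simp add: \<tau>_def cubic_of_def cubic_arith cubic.expand)

text \<open>
  The tuple \<open>(a, b0, b1, b2, c0, c1, c2, d)\<close> stands for
  \<open>a + s b0 + t s b1 + t\<^sup>2 s b2 + s\<^sup>2 c0 + t s\<^sup>2 c1 + t\<^sup>2 s\<^sup>2 c2 + s t\<^sup>2 s d\<close> with \<open>\<tau>\<close> read as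
  \<open>t\<close>, and \<open>gen_act\<close> is what left multiplication does to it. The only columns of \<open>gs\<close> that are
  not immediate are those of \<open>c2\<close> and \<open>d\<close>; see \<open>s_tt_ss\<close> and \<open>ss_tt_s\<close> below.
\<close>

type_synonym vec = "cubic \<times> cubic \<times> cubic \<times> cubic \<times> cubic \<times> cubic \<times> cubic \<times> cubic"

lemma vec_cases:
  obtains a b0 b1 b2 c0 c1 c2 d where "v = (a, b0, b1, b2, c0, c1, c2, d :: cubic)"
  by (cases v) auto

text \<open>Models right multiplication by a polynomial in \<open>t\<close>, so it commutes with the
  left action of the generators.\<close>

fun vscale :: "cubic \<Rightarrow> vec \<Rightarrow> vec" where
  "vscale k (a, b0, b1, b2, c0, c1, c2, d) =
     (k * a, k * b0, k * b1, k * b2, k * c0, k * c1, k * c2, k * d)"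

fun gen_act :: "generator \<Rightarrow> vec \<Rightarrow> vec" where
  "gen_act gs (a, b0, b1, b2, c0, c1, c2, d) =
     (c0,
      a + X1 * c0 + X1 * (\<tau> * \<tau>) * c2,
      \<tau> * b1,
      \<tau> * c1 + X1 * d,
      b0 + X2 * c0 - X1 * \<tau> * c2,
      (\<tau> * \<tau> - X2 * \<tau> - X1) * d - X2 * \<tau> * c2,
      \<tau> * c2,
      b2 + X2 * c2 + X2 * d)"
| "gen_act gt (a, b0, b1, b2, c0, c1, c2, d) =
     (\<tau> * a,
      b2, b0 + X1 * b2, b1 + X2 * b2,
      c2, c0 + X1 * c2, c1 + X2 * c2,
      \<tau> * d)"

lemma vscale_add_left: "vscale (k + l) v = vscale k v + vscale l v"
  by (cases v rule: vec_cases) (simp add: algebra_simps)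

lemma vscale_add_right: "vscale k (v + w) = vscale k v + vscale k w"
  by (cases v rule: vec_cases; cases w rule: vec_cases) (simp add: algebra_simps)

lemma vscale_vscale: "vscale k (vscale l v) = vscale (k * l) v"
  by (cases v rule: vec_cases) (simp add: algebra_simps)

lemma vscale_0 [simp]: "vscale 0 v = 0"
  by (cases v rule: vec_cases) (simp add: zero_prod_def)

lemma vscale_0_right [simp]: "vscale k 0 = 0"
  by (simp add: zero_prod_def)

lemma vscale_1 [simp]: "vscale 1 v = v"
  by (cases v rule: vec_cases) simp

lemma gen_act_add: "gen_act x (v + w) = gen_act x v + gen_act x w"
  by (cases x; cases v rule: vec_cases; cases w rule: vec_cases) (simp_all add: algebra_simps)

lemma gen_act_vscale: "gen_act x (vscale k v) = vscale k (gen_act x v)"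
  by (cases x; cases v rule: vec_cases) (simp_all add: algebra_simps)

lemma gen_act_cubic:
  "gen_act x (gen_act x (gen_act x v)) = v + vscale X1 (gen_act x v) + vscale X2 (gen_act x (gen_act x v))"
  by (cases x; cases v rule: vec_cases) (simp_all add: algebra_simps tau_cubed tau_cubed')

lemma gen_act_braid:
  "gen_act gs (gen_act gt (gen_act gs v)) = gen_act gt (gen_act gs (gen_act gt v))"
  by (cases v rule: vec_cases) (simp_all add: algebra_simps tau_cubed tau_cubed')

section \<open>The induced action of the free algebra and of its quotient\<close>

definition free_act :: "(generator, coeff_ring) free_algebra \<Rightarrow> vec \<Rightarrow> vec" where
  "free_act p v =
     (\<Sum>w\<in>Poly_Mapping.keys p. vscale (cubic_of (Poly_Mapping.lookup p w)) (foldr gen_act (letters w) v))"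

lemma free_act_0 [simp]: "free_act 0 v = 0"
  by (simp add: free_act_def)

lemma free_act_single:
  "free_act (Poly_Mapping.single w r) v = vscale (cubic_of r) (foldr gen_act (letters w) v)"
  by (simp add: free_act_def)

lemma free_act_add: "free_act (p + q) v = free_act p v + free_act q v"
proof -
  let ?f = "\<lambda>p w. vscale (cubic_of (Poly_Mapping.lookup p w)) (foldr gen_act (letters w) v)"
  let ?K = "Poly_Mapping.keys p \<union> Poly_Mapping.keys q"
  \<comment> \<open>Cancellation can shrink the support of \<open>p + q\<close>, so all three sums
    are taken over the common set \<open>?K\<close>.\<close>
  have *: "free_act r v = sum (?f r) ?K" if "Poly_Mapping.keys r \<subseteq> ?K" for r
    unfolding free_act_def
    using that by (intro sum.mono_neutral_left) (auto simp: in_keys_iff)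
  show ?thesis
    using Poly_Mapping.keys_add[of p q]
    by (simp add: * lookup_add cubic_of_add vscale_add_left sum.distrib)
qed

lemma foldr_gen_act_add: "foldr gen_act w (v + v') = foldr gen_act w v + foldr gen_act w v'"
  by (induction w) (simp_all add: gen_act_add)

lemma foldr_gen_act_vscale: "foldr gen_act w (vscale k v) = vscale k (foldr gen_act w v)"
  by (induction w) (simp_all add: gen_act_vscale)

lemma free_act_add_right: "free_act p (v + v') = free_act p v + free_act p v'"
  by (simp add: free_act_def foldr_gen_act_add vscale_add_right sum.distrib)

lemma free_act_vscale: "free_act p (vscale k v) = vscale k (free_act p v)"
  by (induction p rule: poly_mapping_single_induct)
    (simp_all add: free_act_single free_act_add vscale_add_right foldr_gen_act_vscale
      vscale_vscale mult.commute)

lemma free_act_0_right [simp]: "free_act p 0 = 0"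
  using free_act_vscale[of p 0 0] by simp

lemma free_act_mult: "free_act (p * q) v = free_act p (free_act q v)"
proof (induction p rule: poly_mapping_single_induct)
  case (single w r)
  show ?case
    by (induction q rule: poly_mapping_single_induct)
      (simp_all add: mult_single free_act_single plus_word_def cubic_of_mult foldr_gen_act_vscale
        vscale_vscale distrib_left free_act_add free_act_add_right)
qed (simp add: distrib_right free_act_add)

lemma free_act_1 [simp]: "free_act 1 v = v"
  by (simp add: free_act_single zero_word_def flip: single_one)

lemma free_act_gen [simp]: "free_act (free_gen x) v = gen_act x v"
  by (simp add: free_gen_def free_act_single)

lemma free_act_const [simp]: "free_act (free_const r) v = vscale (cubic_of r) v"
  by (simp add: free_const_def free_act_single zero_word_def)

lemma free_act_diff: "free_act (p - q) v = free_act p v - free_act q v"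
  by (metis add_diff_cancel_right' diff_add_cancel free_act_add)

lemma free_act_relators: "p \<in> hecke_relators \<Longrightarrow> free_act p v = 0"
  by (auto simp: hecke_relators_def free_act_diff free_act_add free_act_mult gen_act_braid
      gen_act_cubic power2_eq_square power3_eq_cube)

lemma free_act_ideal: "p \<in> two_sided_ideal hecke_relators \<Longrightarrow> free_act p v = 0"
  by (induction rule: two_sided_ideal.induct)
    (simp_all add: free_act_mult free_act_add free_act_relators)

text \<open>Well defined because two representatives differ by an element of the ideal, which acts
  as zero.\<close>

lift_definition hecke_act :: "hecke \<Rightarrow> vec \<Rightarrow> vec" is free_act
  by (rule ext) (metis eq_iff_diff_eq_0 free_act_diff free_act_ideal hecke_eq_def)

lemma hecke_act_add: "hecke_act (x + y) v = hecke_act x v + hecke_act y v"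
  by transfer (rule free_act_add)

lemma hecke_act_mult: "hecke_act (x * y) v = hecke_act x (hecke_act y v)"
  by transfer (rule free_act_mult)

lemma hecke_act_1 [simp]: "hecke_act 1 v = v"
  by transfer simp

lemma hecke_act_gen [simp]: "hecke_act (hecke_gen x) v = gen_act x v"
  by transfer simp

lemma hecke_act_const [simp]: "hecke_act (hecke_const r) v = vscale (cubic_of r) v"
  by (simp add: hecke_const_def hecke_act.abs_eq)

lemma hecke_induct [case_names const gen add mult]:
  assumes "\<And>r. P (hecke_const r)" and "\<And>g. P (hecke_gen g)"
    and "\<And>x y. P x \<Longrightarrow> P y \<Longrightarrow> P (x + y)"
    and "\<And>x y. P x \<Longrightarrow> P y \<Longrightarrow> P (x * y)"
  shows "P x"
proof -
  obtain p where abs_hecke: "x = abs_hecke p"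
    using hecke.abs_induct[of "\<lambda>x. \<exists>p. x = abs_hecke p" x] by blast
  have "P (abs_hecke (Poly_Mapping.single (Word w) r))" for w r
  proof (induction w)
    case Nil
    show ?case
      using assms(1)[of r] by (simp add: hecke_const_def free_const_def zero_word_def)
  next
    case (Cons g w)
    have "abs_hecke (Poly_Mapping.single (Word (g # w)) r)
        = hecke_gen g * abs_hecke (Poly_Mapping.single (Word w) r)"
      by (simp add: hecke_gen.abs_eq times_hecke.abs_eq free_gen_def mult_single plus_word_def)
    with Cons show ?case
      by (simp add: assms)
  qed
  then have "P (abs_hecke p)"
    by (induction p rule: poly_mapping_single_induct)
      (metis word.exhaust, simp add: assms(3) flip: plus_hecke.abs_eq)
  with abs_hecke show ?thesis
    by simp
qed

text \<open>Scalars sit on the empty word and so commute with the generators. This makes the product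
  bilinear although \<open>*\<^sub>H\<close> is defined by left multiplication.\<close>

lemma hecke_const_commute: "hecke_const r * x = x * hecke_const r"
proof (induction x rule: hecke_induct)
  case (const q)
  show ?case by (metis hecke_const_mult mult.commute)
next
  case (gen g)
  show ?case
    by (simp add: hecke_const_def hecke_gen.abs_eq times_hecke.abs_eq free_gen_def free_const_def mult_single)
next
  case (mult x y)
  then show ?case by (metis mult.assoc)
qed (simp add: algebra_simps)

lemma scale_mult_left: "(r *\<^sub>H x) * y = r *\<^sub>H (x * y)"
  by (simp add: hecke_scale_def mult.assoc)

lemma scale_mult_right: "x * (r *\<^sub>H y) = r *\<^sub>H (x * y)"
  by (metis hecke_const_commute hecke_scale_def mult.assoc)

section \<open>Relations in the Hecke algebra\<close>

abbreviation s :: hecke where "s \<equiv> hecke_gen gs"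
abbreviation t :: hecke where "t \<equiv> hecke_gen gt"

lemma hecke_eqI: "p - q \<in> hecke_relators \<Longrightarrow> abs_hecke p = abs_hecke q"
  using two_sided_ideal.gen[of "p - q" hecke_relators 1 1] by (simp add: hecke.abs_eq_iff hecke_eq_def)

lemma hecke_gen_cubic:
  "hecke_gen g * (hecke_gen g * hecke_gen g)
    = 1 + \<xi>\<^sub>1 *\<^sub>H hecke_gen g + \<xi>\<^sub>2 *\<^sub>H (hecke_gen g * hecke_gen g)"
proof -
  have "abs_hecke (free_gen g ^ 3)
      = abs_hecke (1 + free_const \<xi>\<^sub>1 * free_gen g + free_const \<xi>\<^sub>2 * free_gen g ^ 2)"
    by (rule hecke_eqI) (auto simp: hecke_relators_def)
  then show ?thesis
    by (simp add: power2_eq_square power3_eq_cube hecke_scale_def hecke_const_def hecke_gen.abs_eq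
        one_hecke_def mult.assoc flip: times_hecke.abs_eq plus_hecke.abs_eq)
qed

lemma hecke_braid: "s * (t * s) = t * (s * t)"
proof -
  have "abs_hecke (free_gen gs * free_gen gt * free_gen gs)
      = abs_hecke (free_gen gt * free_gen gs * free_gen gt)"
    by (rule hecke_eqI) (auto simp: hecke_relators_def)
  then show ?thesis
    by (simp add: hecke_gen.abs_eq mult.assoc flip: times_hecke.abs_eq)
qed

lemma left_mult_eq: "x = y \<Longrightarrow> x * z = y * (z :: 'a::semigroup_mult)"
  by simp

lemmas scale_mult = scale_mult_left scale_mult_right

lemma hecke_gen_cubic': "hecke_gen g * (hecke_gen g * (hecke_gen g * y))
    = y + \<xi>\<^sub>1 *\<^sub>H (hecke_gen g * y) + \<xi>\<^sub>2 *\<^sub>H (hecke_gen g * (hecke_gen g * y))"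
  using left_mult_eq[OF hecke_gen_cubic, of g y]
  by (simp add: algebra_simps scale_mult)

lemma hecke_braid': "s * (t * (s * y)) = t * (s * (t * y))"
  using left_mult_eq[OF hecke_braid, of y] by (simp add: mult.assoc)

text \<open>Two braid moves: \<open>t s t t s = s t s t s = s t t s t\<close>.\<close>

lemma t_stts: "t * (s * (t * (t * (s * y)))) = s * (t * (t * (s * (t * y))))"
  by (metis hecke_braid')

text \<open>The inverse of a generator \<open>g\<close>, from the cubic relation read as \<open>g *
  (g * g - \<xi>\<^sub>2 *\<^sub>H g - \<xi>\<^sub>1 *\<^sub>H 1) = 1\<close>.\<close>

definition hecke_inv :: "generator \<Rightarrow> hecke" where
  "hecke_inv g = hecke_gen g * hecke_gen g - \<xi>\<^sub>2 *\<^sub>H hecke_gen g - \<xi>\<^sub>1 *\<^sub>H 1"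

lemma hecke_gen_inv: "hecke_gen g * hecke_inv g = 1"
  and hecke_inv_gen: "hecke_inv g * hecke_gen g = 1"
  by (simp_all add: hecke_inv_def algebra_simps scale_mult hecke_gen_cubic)

text \<open>In the braid group \<open>s t\<^sup>2 s\<^sup>-\<^sup>1 = t\<^sup>-\<^sup>1 s\<^sup>2 t\<close> and \<open>s\<^sup>-\<^sup>1 t\<^sup>2 s = t s\<^sup>2 t\<^sup>-\<^sup>1\<close>.\<close>

lemma s_tt_ss:
  "s * (t * (t * (s * s))) = \<xi>\<^sub>2 *\<^sub>H (s * (t * (t * s))) + \<xi>\<^sub>1 *\<^sub>H (s * (t * t))
     + hecke_inv gt * (s * (s * t))"
proof -
  \<comment> \<open>After prefixing \<open>hecke_inv gt * t\<close>, two braid moves bring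
    \<open>s\<close> next to \<open>hecke_inv gs\<close>.\<close>
  have "s * (t * (t * hecke_inv gs)) = hecke_inv gt * (t * (s * (t * (t * hecke_inv gs))))"
    by (metis hecke_inv_gen mult.assoc mult_1)
  also have "t * (s * (t * (t * hecke_inv gs))) = s * (s * (t * (s * hecke_inv gs)))"
    by (metis hecke_braid')
  also have "\<dots> = s * (s * t)"
    by (simp add: hecke_gen_inv)
  \<comment> \<open>Writing out \<open>hecke_inv gs\<close> and solving for the term ending in
    \<open>s * s\<close> gives the claim.\<close>
  finally show ?thesis
    by (simp add: hecke_inv_def[of gs] algebra_simps scale_mult)
qed

lemma ss_tt_s:
  "s * (s * (t * (t * s))) = \<xi>\<^sub>2 *\<^sub>H (s * (t * (t * s))) + \<xi>\<^sub>1 *\<^sub>H (t * (t * s))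
     + t * (s * (s * hecke_inv gt))"
proof -
  have "hecke_inv gs * (t * (t * s)) = hecke_inv gs * (t * (t * (s * (t * hecke_inv gt))))"
    by (simp add: hecke_gen_inv)
  also have "t * (t * (s * (t * hecke_inv gt))) = s * (t * (s * (s * hecke_inv gt)))"
    by (metis hecke_braid')
  also have "hecke_inv gs * \<dots> = t * (s * (s * hecke_inv gt))"
    by (metis hecke_inv_gen mult.assoc mult_1)
  finally show ?thesis
    by (simp add: hecke_inv_def[of gs] algebra_simps scale_mult)
qed

section \<open>The isomorphism between the rank 8 module and the Hecke algebra\<close>

definition poly_t :: "cubic \<Rightarrow> hecke" where
  "poly_t a = cubic0 a *\<^sub>H 1 + cubic1 a *\<^sub>H t + cubic2 a *\<^sub>H (t * t)"

lemma poly_t_0 [simp]: "poly_t 0 = 0"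
  and poly_t_1 [simp]: "poly_t 1 = 1"
  and poly_t_tau [simp]: "poly_t \<tau> = t"
  and poly_t_of [simp]: "poly_t (cubic_of r) = r *\<^sub>H 1"
  and poly_t_add: "poly_t (a + b) = poly_t a + poly_t b"
  and poly_t_diff: "poly_t (a - b) = poly_t a - poly_t b"
  by (simp_all add: poly_t_def cubic_of_def \<tau>_def cubic_arith algebra_simps)

text \<open>\<open>t\<close> satisfies the cubic relation that defines \<open>cubic\<close>, so
  evaluation at \<open>t\<close> respects products.\<close>

lemma poly_t_mult: "poly_t (a * b) = poly_t a * poly_t b"
  by (simp add: poly_t_def times_cubic_def Let_def algebra_simps scale_mult hecke_gen_cubic hecke_gen_cubic')

lemma poly_t_commute: "poly_t a * poly_t b = poly_t b * poly_t a"
  by (metis mult.commute poly_t_mult)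

lemma poly_t_t: "poly_t a * t = t * poly_t a"
  using poly_t_commute[of a \<tau>] by simp

lemma poly_t_t': "poly_t a * (t * y) = t * (poly_t a * y)"
  by (metis mult.assoc poly_t_t)

fun of_vec :: "vec \<Rightarrow> hecke" where
  "of_vec (a, b0, b1, b2, c0, c1, c2, d) =
     poly_t a
     + s * poly_t b0 + t * (s * poly_t b1) + t * (t * (s * poly_t b2))
     + s * (s * poly_t c0) + t * (s * (s * poly_t c1)) + t * (t * (s * (s * poly_t c2)))
     + s * (t * (t * (s * poly_t d)))"

lemma of_vec_add: "of_vec (v + w) = of_vec v + of_vec w"
  by (cases v rule: vec_cases; cases w rule: vec_cases) (simp add: poly_t_add algebra_simps)

lemma of_vec_vscale: "of_vec (vscale k v) = of_vec v * poly_t k"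
  by (cases v rule: vec_cases)
    (simp add: poly_t_mult algebra_simps poly_t_commute[of k])

lemma of_vec_gen_act: "of_vec (gen_act g v) = hecke_gen g * of_vec v"
proof -
  \<comment> \<open>The extra right factor makes the relations for the columns \<open>c2\<close> and
    \<open>d\<close> applicable in front of \<open>poly_t\<close>.\<close>
  note * = left_mult_eq[OF s_tt_ss, simplified mult.assoc distrib_right scale_mult_left]
    left_mult_eq[OF ss_tt_s, simplified mult.assoc distrib_right scale_mult_left]
  show ?thesis
    by (cases g; cases v rule: vec_cases)
      (simp_all add: poly_t_add poly_t_diff poly_t_mult hecke_inv_def algebra_simps scale_mult
        hecke_gen_cubic' hecke_braid' t_stts * poly_t_t poly_t_t')
qed

definition e1 :: vec where
  "e1 = (1, 0, 0, 0, 0, 0, 0, 0)"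

lemma of_vec_act: "of_vec (hecke_act x v) = x * of_vec v"
proof (induction x arbitrary: v rule: hecke_induct)
  case (const r)
  show ?case by (simp add: of_vec_vscale hecke_scale_def hecke_const_commute)
qed (simp_all add: hecke_act_add hecke_act_mult of_vec_add of_vec_gen_act distrib_right mult.assoc)

text \<open>\<open>e1\<close> represents 1, so acting on it gives a right inverse of
  \<open>of_vec\<close>, which is therefore onto.\<close>

lemma of_vec_act_e1: "of_vec (hecke_act x e1) = x"
  by (simp add: of_vec_act) (simp add: e1_def)

lemma hecke_act_scale: "hecke_act (r *\<^sub>H x) v = vscale (cubic_of r) (hecke_act x v)"
  by (simp add: hecke_scale_def hecke_act_mult)

lemma act_poly_t_e1: "hecke_act (poly_t a) e1 = vscale a e1"
  by (subst (2) cubic_expand)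
    (simp add: poly_t_def hecke_act_add hecke_act_mult hecke_act_scale e1_def algebra_simps)

text \<open>The other composite: it makes \<open>of_vec\<close> injective, which proves freeness of
  rank 24 over \<open>R\<close>.\<close>

lemma act_of_vec_e1: "hecke_act (of_vec v) e1 = v"
  by (cases v rule: vec_cases)
    (simp add: hecke_act_add hecke_act_mult act_poly_t_e1, simp add: e1_def)

lemma of_vec_inject: "of_vec v = of_vec w \<longleftrightarrow> v = w"
  by (metis act_of_vec_e1)

section \<open>The centralizer\<close>

text \<open>Under the bijection \<open>of_vec\<close>, left multiplication by \<open>t\<close> is
  \<open>gen_act gt\<close> and right multiplication is \<open>vscale \<tau>\<close>.\<close>

lemma centralizer_of_vec: "of_vec v \<in> centralizer t \<longleftrightarrow> gen_act gt v = vscale \<tau> v"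
proof -
  have "of_vec v \<in> centralizer t \<longleftrightarrow> of_vec (vscale \<tau> v) = of_vec (gen_act gt v)"
    by (simp add: centralizer_def of_vec_vscale of_vec_gen_act)
  then show ?thesis
    by (auto simp: of_vec_inject)
qed

text \<open>
  The solutions of \<open>gen_act gt v = vscale \<tau> v\<close>: the three coordinates \<open>b0, b1, b2\<close> are determined
  by the first, through the Casimir element
  \<open>1 \<otimes> 1 + t \<otimes> (t\<^sup>2 - \<xi>\<^sub>2 t) + t\<^sup>2 \<otimes> t\<close> of \<open>R[t]\<close>, and likewise \<open>c0, c1, c2\<close>.
\<close>

definition cent_vec :: "cubic \<Rightarrow> cubic \<Rightarrow> cubic \<Rightarrow> cubic \<Rightarrow> vec" where
  "cent_vec a b c d =
     (a, b, (\<tau> * \<tau> - X2 * \<tau>) * b, \<tau> * b, c, (\<tau> * \<tau> - X2 * \<tau>) * c, \<tau> * c, d)"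

lemma gen_act_t_eq_vscale_iff: "gen_act gt v = vscale \<tau> v \<longleftrightarrow> (\<exists>a b c d. v = cent_vec a b c d)"
proof
  assume *: "gen_act gt v = vscale \<tau> v"
  obtain a b0 b1 b2 c0 c1 c2 d where v: "v = (a, b0, b1, b2, c0, c1, c2, d)"
    by (rule vec_cases)
  have b2: "b2 = \<tau> * b0" and c2: "c2 = \<tau> * c0"
    using * by (simp_all add: v)
  have "b1 = \<tau> * b2 - X2 * b2" "c1 = \<tau> * c2 - X2 * c2"
    using * by (auto simp: v eq_diff_eq)
  then have "v = cent_vec a b0 c0 d"
    by (simp add: v cent_vec_def b2 c2 left_diff_distrib mult.assoc)
  then show "\<exists>a b c d. v = cent_vec a b c d"
    by blast
next
  assume "\<exists>a b c d. v = cent_vec a b c d"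
  then show "gen_act gt v = vscale \<tau> v"
    by (auto simp: cent_vec_def algebra_simps tau_cubed tau_cubed')
qed

lemma centralizer_t: "centralizer t = {of_vec (cent_vec a b c d) | a b c d. True}"
proof (rule set_eqI)
  fix x
  obtain v where "x = of_vec v"
    by (metis of_vec_act_e1)
  then show "x \<in> centralizer t \<longleftrightarrow> x \<in> {of_vec (cent_vec a b c d) | a b c d. True}"
    by (simp add: centralizer_of_vec gen_act_t_eq_vscale_iff of_vec_inject)
qed

definition cent_basis :: "hecke list" where
  "cent_basis =
    [T [],
     T [gt],
     T [gt, gt],
     T [gs, gt, gt, gs],
     T [gs, gs, gt, gs, gs],
     T [gs, gt, gs, gt, gs, gt],
     T [gs] + T [gt, gt, gs, gt] + T [gt, gs, gt, gt] - \<xi>\<^sub>2 *\<^sub>H T [gt, gs, gt],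
     T [gs, gs] + T [gt, gt, gs, gs, gt] + T [gt, gs, gs, gt, gt] - \<xi>\<^sub>2 *\<^sub>H T [gt, gs, gs, gt],
     T [gt, gs] + T [gs, gt] + T [gt, gt, gs, gt, gt] + \<xi>\<^sub>1 *\<^sub>H T [gt, gs, gt],
     T [gt, gs, gs] + T [gs, gs, gt] + T [gt, gt, gs, gs, gt, gt] + \<xi>\<^sub>1 *\<^sub>H T [gt, gs, gs, gt],
     T [gt, gt, gs] + T [gs, gt, gt] + T [gt, gs, gt]
       + \<xi>\<^sub>1 *\<^sub>H T [gt, gt, gs, gt] + \<xi>\<^sub>1 *\<^sub>H T [gt, gs, gt, gt] + \<xi>\<^sub>2 *\<^sub>H T [gt, gt, gs, gt, gt],
     T [gt, gt, gs, gs] + T [gs, gs, gt, gt] + T [gt, gs, gs, gt]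
       + \<xi>\<^sub>1 *\<^sub>H T [gt, gt, gs, gs, gt] + \<xi>\<^sub>1 *\<^sub>H T [gt, gs, gs, gt, gt]
       + \<xi>\<^sub>2 *\<^sub>H T [gt, gt, gs, gs, gt, gt]]"

lemma length_cent_basis: "length cent_basis = 12"
  by (simp add: cent_basis_def)

lemma T_Nil: "T [] = 1" and T_Cons: "T (g # w) = hecke_gen g * T w"
  by (simp_all add: T_def)

text \<open>Positions 6, 8, 10 hold the Casimir element applied to \<open>s\<close>, times
  \<open>1, t, t^2\<close>; positions 7, 9, 11 hold the same for \<open>s * s\<close>. This explains
  the interleaved indices.\<close>

lemma cent_basis_sum:
  "(\<Sum>i<12. c i *\<^sub>H cent_basis ! i) =
     of_vec (cent_vec (Cubic (c 0) (c 1) (c 2)) (Cubic (c 6) (c 8) (c 10))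
       (Cubic (c 7) (c 9) (c 11)) (Cubic (c 3) (c 4) (c 5)))"
proof -
  have tt: "poly_t (\<tau> * \<tau> - X2 * \<tau>) = t * t - \<xi>\<^sub>2 *\<^sub>H t"
    by (simp add: poly_t_mult poly_t_diff scale_mult)
  \<comment> \<open>The Casimir element with \<open>m\<close> in place of the tensor sign, times
    \<open>poly_t b\<close> on the right.\<close>
  define K where "K m b = m * poly_t b + t * (m * ((t * t - \<xi>\<^sub>2 *\<^sub>H t) * poly_t b))
    + t * (t * (m * (t * poly_t b)))" for m b
  have K: "K m (Cubic k0 k1 k2) =
      k0 *\<^sub>H (m + t * (t * (m * t)) + t * (m * (t * t)) - \<xi>\<^sub>2 *\<^sub>H (t * (m * t)))
    + k1 *\<^sub>H (t * m + m * t + t * (t * (m * (t * t))) + \<xi>\<^sub>1 *\<^sub>H (t * (m * t)))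
    + k2 *\<^sub>H (t * (t * m) + m * (t * t) + t * (m * t) + \<xi>\<^sub>1 *\<^sub>H (t * (t * (m * t)))
        + \<xi>\<^sub>1 *\<^sub>H (t * (m * (t * t))) + \<xi>\<^sub>2 *\<^sub>H (t * (t * (m * (t * t)))))" for m k0 k1 k2
    by (simp add: K_def poly_t_def algebra_simps scale_mult hecke_gen_cubic hecke_gen_cubic')
  have "of_vec (cent_vec a b c' d) =
      poly_t a + K s b + K (s * s) c' + s * (t * (t * (s * poly_t d)))" for a b c' d
    by (simp add: cent_vec_def K_def poly_t_mult tt mult.assoc add_ac)
  then show ?thesis
    by (simp only: K)
      (simp add: cent_basis_def eval_nat_numeral T_Nil T_Cons poly_t_def mult.assoc
        distrib_left scale_mult hecke_braid hecke_braid' t_stts ac_simps)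
qed

theorem corollary3p5:
  "let zs =
    [T [],
     T [gt],
     T [gt, gt],
     T [gs, gt, gt, gs],
     T [gs, gs, gt, gs, gs],
     T [gs, gt, gs, gt, gs, gt],
     T [gs] + T [gt, gt, gs, gt] + T [gt, gs, gt, gt] - \<xi>\<^sub>2 *\<^sub>H T [gt, gs, gt],
     T [gs, gs] + T [gt, gt, gs, gs, gt] + T [gt, gs, gs, gt, gt] - \<xi>\<^sub>2 *\<^sub>H T [gt, gs, gs, gt],
     T [gt, gs] + T [gs, gt] + T [gt, gt, gs, gt, gt] + \<xi>\<^sub>1 *\<^sub>H T [gt, gs, gt],
     T [gt, gs, gs] + T [gs, gs, gt] + T [gt, gt, gs, gs, gt, gt] + \<xi>\<^sub>1 *\<^sub>H T [gt, gs, gs, gt],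
     T [gt, gt, gs] + T [gs, gt, gt] + T [gt, gs, gt]
       + \<xi>\<^sub>1 *\<^sub>H T [gt, gt, gs, gt] + \<xi>\<^sub>1 *\<^sub>H T [gt, gs, gt, gt] + \<xi>\<^sub>2 *\<^sub>H T [gt, gt, gs, gt, gt],
     T [gt, gt, gs, gs] + T [gs, gs, gt, gt] + T [gt, gs, gs, gt]
       + \<xi>\<^sub>1 *\<^sub>H T [gt, gt, gs, gs, gt] + \<xi>\<^sub>1 *\<^sub>H T [gt, gs, gs, gt, gt]
       + \<xi>\<^sub>2 *\<^sub>H T [gt, gt, gs, gs, gt, gt]]
   in distinct zs \<and> hecke.independent (set zs) \<and> hecke.span (set zs) = centralizer (T [gt])"
proof -
  have zero: "c i = 0" if "(\<Sum>i<12. c i *\<^sub>H cent_basis ! i) = 0" "i < 12" for c i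
  proof -
    have "of_vec 0 = 0"
      by (simp add: zero_prod_def)
    with that have "cent_vec (Cubic (c 0) (c 1) (c 2)) (Cubic (c 6) (c 8) (c 10))
       (Cubic (c 7) (c 9) (c 11)) (Cubic (c 3) (c 4) (c 5)) = 0"
      by (metis cent_basis_sum of_vec_inject)
    \<comment> \<open>The first, second, fifth and eighth components of \<open>cent_vec\<close> are
      its arguments themselves.\<close>
    then have "\<forall>i\<in>{0,1,2,3,4,5,6,7,8,9,10,11}. c i = 0"
      by (simp add: cent_vec_def zero_prod_def zero_cubic_def)
    moreover have "i \<in> {0,1,2,3,4,5,6,7,8,9,10,11}"
      using that(2) unfolding insert_iff empty_iff by presburger
    ultimately show ?thesis
      by blast
  qed
  then have *: "distinct cent_basis \<and> hecke.independent (set cent_basis)"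
    by (intro hecke.distinct_independent_listI) (simp_all add: length_cent_basis)
  have "of_vec (cent_vec a b c d) \<in> range (\<lambda>c. \<Sum>i<12. c i *\<^sub>H cent_basis ! i)" for a b c d
    \<comment> \<open>The coefficients follow the order of \<open>cent_basis\<close>: those of
      \<open>a\<close>, then of \<open>d\<close>, then \<open>b\<close> and \<open>c\<close>
      alternating.\<close>
    by (rule image_eqI[of _ _ "(!) [cubic0 a, cubic1 a, cubic2 a, cubic0 d, cubic1 d, cubic2 d,
        cubic0 b, cubic0 c, cubic1 b, cubic1 c, cubic2 b, cubic2 c]"])
      (simp_all add: cent_basis_sum)
  moreover have "(\<Sum>i<12. c i *\<^sub>H cent_basis ! i) \<in> centralizer t" for c
    unfolding cent_basis_sum centralizer_t by blast
  ultimately have "range (\<lambda>c. \<Sum>i<12. c i *\<^sub>H cent_basis ! i) = centralizer t"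
    unfolding centralizer_t by blast
  with * show ?thesis
    unfolding Let_def cent_basis_def[symmetric]
    by (simp add: hecke.span_set_list length_cent_basis T_Cons T_Nil)
qed

end
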